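(* Let $(T,S,N)$ be a relative Rota-Baxter-Nijenhuis structure on a LieYRep pair $((\mathfrak g,[\cdot,\cdot],[\![\cdot,\cdot,\cdot]\!]),(V;\rho,\mu))$ satisfying $$D(Tu,Tv)(Sw)+\mu(Tv,Tw)(Su)-\mu(Tu,Tw)(Sv)=S\big([\![u,v,w]\!]^T\big),\qquad\forall u,v,w\in V.$$ Then $T$ and $T\circ S$ are compatible relative Rota-Baxter operators on $\mathfrak g$ with respect to $(V;\rho,\mu)$.
   Context: All vector spaces are finite-dimensional over a field $\mathbb K$ of characteristic $0$. A Lie-Yamaguti algebra is a vector space $\mathfrak g$ with a bilinear map $[\cdot,\cdot]:\wedge^2\mathfrak g\to\mathfrak g$ and a trilinear map $[\![\cdot,\cdot,\cdot]\!]:\wedge^2\mathfrak g\otimes\mathfrak g\to\mathfrak g$ such that for all $x,y,z,w,t\in\mathfrak g$: (1) $[[x,y],z]+[[y,z],x]+[[z,x],y]+[\![x,y,z]\!]+[\![y,z,x]\!]+[\![z,x,y]\!]=0$; (2) $[\![[x,y],z,w]\!]+[\![[y,z],x,w]\!]+[\![[z,x],y,w]\!]=0$; (3) $[\![x,y,[z,w]]\!]=[[\![x,y,z]\!],w]+[z,[\![x,y,w]\!]]$; (4) $[\![x,y,[\![z,w,t]\!]]\!]=[\![[\![x,y,z]\!],w,t]\!]+[\![z,[\![x,y,w]\!],t]\!]+[\![z,w,[\![x,y,t]\!]]\!]$. A representation $(V;\rho,\mu)$ of $\mathfrak g$ is a vector space $V$ with linear maps $\rho:\mathfrak g\to\mathfrak{gl}(V)$,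 $\mu:\otimes^2\mathfrak g\to\mathfrak{gl}(V)$ such that, with $D(x,y)=D_{\rho,\mu}(x,y):=\mu(y,x)-\mu(x,y)+[\rho(x),\rho(y)]-\rho([x,y])$, for all $x,y,z,w\in\mathfrak g$: $\mu([x,y],z)-\mu(x,z)\rho(y)+\mu(y,z)\rho(x)=0$; $\mu(x,[y,z])-\rho(y)\mu(x,z)+\rho(z)\mu(x,y)=0$; $\rho([\![x,y,z]\!])=[D(x,y),\rho(z)]$; $\mu(z,w)\mu(x,y)-\mu(y,w)\mu(x,z)-\mu(x,[\![y,z,w]\!])+D(y,z)\mu(x,w)=0$; $\mu([\![x,y,z]\!],w)+\mu(z,[\![x,y,w]\!])=[D(x,y),\mu(z,w)]$. A Lie-Yamaguti algebra together with a representation is called a LieYRep pair. Nijenhuis operator on a Lie-Yamaguti algebra: a linear map $N:\mathfrak g\to\mathfrak g$ such that, with $[x,y]_N=[Nx,y]+[x,Ny]-N[x,y]$ and $[\![x,y,z]\!]_N=[\![Nx,Ny,z]\!]+[\![x,Ny,Nz]\!]+[\![Nx,y,Nz]\!]-N([\![Nx,y,z]\!]+[\![x,Ny,z]\!]+[\![x,y,Nz]\!])+N^2[\![x,y,z]\!]$, one has $[Nx,Ny]=N[x,y]_N$ and $[\![Nx,Ny,Nz]\!]=N[\![x,y,z]\!]_N$. Nijenhuis structure on a LieYRep pair: a pair $(N,S)$ with $N\in\mathfrak{gl}(\mathfrak g)$, $S\in\mathfrak{gl}(V)$ such that $N$ is a Nijenhuis operator on $\mathfrak g$ and for all $x,y\in\mathfrak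 g$: $\rho(Nx)\circ S=S\circ(\rho(Nx)+\rho(x)\circ S-S\circ\rho(x))$ and $\mu(Nx,Ny)\circ S=S\circ\big(\mu(Nx,y)\circ S+\mu(x,Ny)\circ S+\mu(Nx,Ny)-S\circ(\mu(Nx,y)+\mu(x,Ny)+\mu(x,y)\circ S)+S^2\circ\mu(x,y)\big)$. For a linear map $T:V\to\mathfrak g$ put $[u,v]^T=\rho(Tu)v-\rho(Tv)u$ and $[\![u,v,w]\!]^T=D(Tu,Tv)w+\mu(Tv,Tw)u-\mu(Tu,Tw)v$. $T$ is a relative Rota-Baxter operator on $\mathfrak g$ with respect to $(V;\rho,\mu)$ if $[Tu,Tv]=T[u,v]^T$ and $[\![Tu,Tv,Tw]\!]=T[\![u,v,w]\!]^T$ for all $u,v,w\in V$. Further, $[u,v]^T_S=[Su,v]^T+[u,Sv]^T-S[u,v]^T$ and $[\![u,v,w]\!]^T_S=[\![Su,Sv,w]\!]^T+[\![Su,v,Sw]\!]^T+[\![u,Sv,Sw]\!]^T-S([\![Su,v,w]\!]^T+[\![u,Sv,w]\!]^T+[\![u,v,Sw]\!]^T)+S^2[\![u,v,w]\!]^T$. Relative Rota-Baxter-Nijenhuis structure: a triple $(T,S,N)$ where $(N,S)$ is a Nijenhuis structure on the pair, $T$ is a relative Rota-Baxter operator, and for all $u,v,w\in V$: $N\circ T=T\circ S$, $[u,v]^T_S=[u,v]^{N\circ T}$, $[\![u,v,w]\!]^T_S=[\![u,v,w]\!]^{N\circ T}$. Two relative Rota-Baxter operators $T_1,T_2:V\to\mathfrak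 g$ with respect to $(V;\rho,\mu)$ are compatible if $k_1T_1+k_2T_2$ is a relative Rota-Baxter operator on $\mathfrak g$ with respect to $(V;\rho,\mu)$ for all $k_1,k_2\in\mathbb K$. *)

theory Defs
  imports Complex_Main
begin

text \<open>
  Vector spaces are whole types with an explicit scalar multiplication. An element of
  \<open>gl(V)\<close> is a linear function on \<open>V\<close>, and identities between endomorphisms are written
  pointwise. Multilinearity is linearity in each argument, and a map on the second exterior
  power is a map alternating in the first two arguments.
\<close>

locale lie_yamaguti_algebra = finite_dimensional_vector_space scale Basis
  for scale :: "'k::field_char_0 \<Rightarrow> 'g::ab_group_add \<Rightarrow> 'g" and Basis :: "'g set" +
  fixes br :: "'g \<Rightarrow> 'g \<Rightarrow> 'g"
    and tr :: "'g \<Rightarrow> 'g \<Rightarrow> 'g \<Rightarrow> 'g"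
  assumes br_linear1: "Vector_Spaces.linear scale scale (\<lambda>x. br x y)"
    and br_linear2: "Vector_Spaces.linear scale scale (\<lambda>y. br x y)"
    and br_alternating: "br x x = 0"
    and tr_linear1: "Vector_Spaces.linear scale scale (\<lambda>x. tr x y z)"
    and tr_linear2: "Vector_Spaces.linear scale scale (\<lambda>y. tr x y z)"
    and tr_linear3: "Vector_Spaces.linear scale scale (\<lambda>z. tr x y z)"
    and tr_alternating: "tr x x z = 0"
    and ly1: "br (br x y) z + br (br y z) x + br (br z x) y
                + tr x y z + tr y z x + tr z x y = 0"
    and ly2: "tr (br x y) z w + tr (br y z) x w + tr (br z x) y w = 0"
    and ly3: "tr x y (br z w) = br (tr x y z) w + br z (tr x y w)"
    and ly4: "tr x y (tr z w t) = tr (tr x y z) w t + tr z (tr x y w) t + tr z w (tr x y t)"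

definition rep_D ::
  "('g \<Rightarrow> 'g \<Rightarrow> 'g) \<Rightarrow> ('g \<Rightarrow> 'v \<Rightarrow> 'v) \<Rightarrow> ('g \<Rightarrow> 'g \<Rightarrow> 'v \<Rightarrow> 'v) \<Rightarrow> 'g \<Rightarrow> 'g \<Rightarrow> 'v \<Rightarrow> 'v::ab_group_add"
  where "rep_D br \<rho> \<mu> x y v =
    \<mu> y x v - \<mu> x y v + (\<rho> x (\<rho> y v) - \<rho> y (\<rho> x v)) - \<rho> (br x y) v"

locale lieyrep_pair =
  lie_yamaguti_algebra scale_g Basis_g br tr +
  V: finite_dimensional_vector_space scale_v Basis_v
  for scale_g :: "'k::field_char_0 \<Rightarrow> 'g::ab_group_add \<Rightarrow> 'g" and Basis_g :: "'g set"
    and br :: "'g \<Rightarrow> 'g \<Rightarrow> 'g" and tr :: "'g \<Rightarrow> 'g \<Rightarrow> 'g \<Rightarrow> 'g"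
    and scale_v :: "'k \<Rightarrow> 'v::ab_group_add \<Rightarrow> 'v" and Basis_v :: "'v set" +
  fixes \<rho> :: "'g \<Rightarrow> 'v \<Rightarrow> 'v"
    and \<mu> :: "'g \<Rightarrow> 'g \<Rightarrow> 'v \<Rightarrow> 'v"
  assumes \<rho>_linear: "Vector_Spaces.linear scale_g scale_v (\<lambda>x. \<rho> x v)"
    and \<rho>_endo: "Vector_Spaces.linear scale_v scale_v (\<rho> x)"
    and \<mu>_linear1: "Vector_Spaces.linear scale_g scale_v (\<lambda>x. \<mu> x y v)"
    and \<mu>_linear2: "Vector_Spaces.linear scale_g scale_v (\<lambda>y. \<mu> x y v)"
    and \<mu>_endo: "Vector_Spaces.linear scale_v scale_v (\<mu> x y)"
    and rep1: "\<mu> (br x y) z v - \<mu> x z (\<rho> y v) + \<mu> y z (\<rho> x v) = 0"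
    and rep2: "\<mu> x (br y z) v - \<rho> y (\<mu> x z v) + \<rho> z (\<mu> x y v) = 0"
    and rep3: "\<rho> (tr x y z) v = rep_D br \<rho> \<mu> x y (\<rho> z v) - \<rho> z (rep_D br \<rho> \<mu> x y v)"
    and rep4: "\<mu> z w (\<mu> x y v) - \<mu> y w (\<mu> x z v) - \<mu> x (tr y z w) v
                 + rep_D br \<rho> \<mu> y z (\<mu> x w v) = 0"
    and rep5: "\<mu> (tr x y z) w v + \<mu> z (tr x y w) v
                 = rep_D br \<rho> \<mu> x y (\<mu> z w v) - \<mu> z w (rep_D br \<rho> \<mu> x y v)"

text \<open>
  The deformation of a binary and of a ternary operation by an endomorphism. They are used both
  for \<open>[\<cdot>,\<cdot>]\<^sub>N\<close>, \<open>\<lbrakk>\<cdot>,\<cdot>,\<cdot>\<rbrakk>\<^sub>N\<close> on the algebra and for the deformations by \<open>S\<close> of the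
  operations that \<open>T\<close> induces on \<open>V\<close>.
\<close>

definition deform2 :: "('a \<Rightarrow> 'a) \<Rightarrow> ('a \<Rightarrow> 'a \<Rightarrow> 'a) \<Rightarrow> 'a \<Rightarrow> 'a \<Rightarrow> 'a::ab_group_add"
  where "deform2 N b x y = b (N x) y + b x (N y) - N (b x y)"

definition deform3 ::
  "('a \<Rightarrow> 'a) \<Rightarrow> ('a \<Rightarrow> 'a \<Rightarrow> 'a \<Rightarrow> 'a) \<Rightarrow> 'a \<Rightarrow> 'a \<Rightarrow> 'a \<Rightarrow> 'a::ab_group_add"
  where "deform3 N t x y z =
    t (N x) (N y) z + t x (N y) (N z) + t (N x) y (N z)
      - N (t (N x) y z + t x (N y) z + t x y (N z)) + N (N (t x y z))"

definition nijenhuis_operator ::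
  "('k::field \<Rightarrow> 'g \<Rightarrow> 'g) \<Rightarrow> ('g \<Rightarrow> 'g \<Rightarrow> 'g) \<Rightarrow> ('g \<Rightarrow> 'g \<Rightarrow> 'g \<Rightarrow> 'g) \<Rightarrow>
    ('g::ab_group_add \<Rightarrow> 'g) \<Rightarrow> bool"
  where "nijenhuis_operator scale_g br tr N \<longleftrightarrow>
    Vector_Spaces.linear scale_g scale_g N \<and>
    (\<forall>x y. br (N x) (N y) = N (deform2 N br x y)) \<and>
    (\<forall>x y z. tr (N x) (N y) (N z) = N (deform3 N tr x y z))"

definition nijenhuis_structure ::
  "('k::field \<Rightarrow> 'g \<Rightarrow> 'g) \<Rightarrow> ('g \<Rightarrow> 'g \<Rightarrow> 'g) \<Rightarrow> ('g \<Rightarrow> 'g \<Rightarrow> 'g \<Rightarrow> 'g) \<Rightarrow>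
    ('k \<Rightarrow> 'v \<Rightarrow> 'v) \<Rightarrow> ('g \<Rightarrow> 'v \<Rightarrow> 'v) \<Rightarrow> ('g \<Rightarrow> 'g \<Rightarrow> 'v \<Rightarrow> 'v) \<Rightarrow>
    ('g::ab_group_add \<Rightarrow> 'g) \<Rightarrow> ('v::ab_group_add \<Rightarrow> 'v) \<Rightarrow> bool"
  where "nijenhuis_structure scale_g br tr scale_v \<rho> \<mu> N S \<longleftrightarrow>
    nijenhuis_operator scale_g br tr N \<and>
    Vector_Spaces.linear scale_v scale_v S \<and>
    (\<forall>x v. \<rho> (N x) (S v) = S (\<rho> (N x) v + \<rho> x (S v) - S (\<rho> x v))) \<and>
    (\<forall>x y v. \<mu> (N x) (N y) (S v) =
      S (\<mu> (N x) y (S v) + \<mu> x (N y) (S v) + \<mu> (N x) (N y) v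
           - S (\<mu> (N x) y v + \<mu> x (N y) v + \<mu> x y (S v)) + S (S (\<mu> x y v))))"

definition rb_br ::
  "('g \<Rightarrow> 'v \<Rightarrow> 'v) \<Rightarrow> ('v \<Rightarrow> 'g) \<Rightarrow> 'v \<Rightarrow> 'v \<Rightarrow> 'v::ab_group_add"
  where "rb_br \<rho> T u v = \<rho> (T u) v - \<rho> (T v) u"

definition rb_tr ::
  "('g \<Rightarrow> 'g \<Rightarrow> 'g) \<Rightarrow> ('g \<Rightarrow> 'v \<Rightarrow> 'v) \<Rightarrow> ('g \<Rightarrow> 'g \<Rightarrow> 'v \<Rightarrow> 'v) \<Rightarrow> ('v \<Rightarrow> 'g) \<Rightarrow>
    'v \<Rightarrow> 'v \<Rightarrow> 'v \<Rightarrow> 'v::ab_group_add"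
  where "rb_tr br \<rho> \<mu> T u v w =
    rep_D br \<rho> \<mu> (T u) (T v) w + \<mu> (T v) (T w) u - \<mu> (T u) (T w) v"

definition relative_rota_baxter ::
  "('k::field \<Rightarrow> 'g \<Rightarrow> 'g) \<Rightarrow> ('g \<Rightarrow> 'g \<Rightarrow> 'g) \<Rightarrow> ('g \<Rightarrow> 'g \<Rightarrow> 'g \<Rightarrow> 'g) \<Rightarrow>
    ('k \<Rightarrow> 'v \<Rightarrow> 'v) \<Rightarrow> ('g \<Rightarrow> 'v \<Rightarrow> 'v) \<Rightarrow> ('g \<Rightarrow> 'g \<Rightarrow> 'v \<Rightarrow> 'v) \<Rightarrow>
    ('v::ab_group_add \<Rightarrow> 'g::ab_group_add) \<Rightarrow> bool"
  where "relative_rota_baxter scale_g br tr scale_v \<rho> \<mu> T \<longleftrightarrow>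
    Vector_Spaces.linear scale_v scale_g T \<and>
    (\<forall>u v. br (T u) (T v) = T (rb_br \<rho> T u v)) \<and>
    (\<forall>u v w. tr (T u) (T v) (T w) = T (rb_tr br \<rho> \<mu> T u v w))"

definition rota_baxter_nijenhuis ::
  "('k::field \<Rightarrow> 'g \<Rightarrow> 'g) \<Rightarrow> ('g \<Rightarrow> 'g \<Rightarrow> 'g) \<Rightarrow> ('g \<Rightarrow> 'g \<Rightarrow> 'g \<Rightarrow> 'g) \<Rightarrow>
    ('k \<Rightarrow> 'v \<Rightarrow> 'v) \<Rightarrow> ('g \<Rightarrow> 'v \<Rightarrow> 'v) \<Rightarrow> ('g \<Rightarrow> 'g \<Rightarrow> 'v \<Rightarrow> 'v) \<Rightarrow>
    ('v::ab_group_add \<Rightarrow> 'g::ab_group_add) \<Rightarrow> ('v \<Rightarrow> 'v) \<Rightarrow> ('g \<Rightarrow> 'g) \<Rightarrow> bool"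
  where "rota_baxter_nijenhuis scale_g br tr scale_v \<rho> \<mu> T S N \<longleftrightarrow>
    nijenhuis_structure scale_g br tr scale_v \<rho> \<mu> N S \<and>
    relative_rota_baxter scale_g br tr scale_v \<rho> \<mu> T \<and>
    N \<circ> T = T \<circ> S \<and>
    (\<forall>u v. deform2 S (rb_br \<rho> T) u v = rb_br \<rho> (N \<circ> T) u v) \<and>
    (\<forall>u v w. deform3 S (rb_tr br \<rho> \<mu> T) u v w = rb_tr br \<rho> \<mu> (N \<circ> T) u v w)"

definition compatible_rota_baxter ::
  "('k::field \<Rightarrow> 'g \<Rightarrow> 'g) \<Rightarrow> ('g \<Rightarrow> 'g \<Rightarrow> 'g) \<Rightarrow> ('g \<Rightarrow> 'g \<Rightarrow> 'g \<Rightarrow> 'g) \<Rightarrow>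
    ('k \<Rightarrow> 'v \<Rightarrow> 'v) \<Rightarrow> ('g \<Rightarrow> 'v \<Rightarrow> 'v) \<Rightarrow> ('g \<Rightarrow> 'g \<Rightarrow> 'v \<Rightarrow> 'v) \<Rightarrow>
    ('v::ab_group_add \<Rightarrow> 'g::ab_group_add) \<Rightarrow> ('v \<Rightarrow> 'g) \<Rightarrow> bool"
  where "compatible_rota_baxter scale_g br tr scale_v \<rho> \<mu> T\<^sub>1 T\<^sub>2 \<longleftrightarrow>
    relative_rota_baxter scale_g br tr scale_v \<rho> \<mu> T\<^sub>1 \<and>
    relative_rota_baxter scale_g br tr scale_v \<rho> \<mu> T\<^sub>2 \<and>
    (\<forall>k\<^sub>1 k\<^sub>2. relative_rota_baxter scale_g br tr scale_v \<rho> \<mu>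
       (\<lambda>u. scale_g k\<^sub>1 (T\<^sub>1 u) + scale_g k\<^sub>2 (T\<^sub>2 u)))"

end

theory Submission imports Defs begin

text \<open>
  Write \<open>R = k T + l T S\<close>. Since \<open>N T = T S\<close>, this is both \<open>(k + l N) T\<close> and \<open>T (k + l S)\<close>. Both
  sides of each Rota-Baxter identity for \<open>R\<close> are homogeneous polynomials in \<open>k\<close> and \<open>l\<close>, of
  degree \<open>2\<close> for the bracket and \<open>3\<close> for the ternary operation, and the coefficients agree one by
  one.

  Consider the ternary operation. On the left, multilinearity gives as coefficient of degree \<open>i\<close>
  in \<open>l\<close> the sum of all \<open>\<lbrakk>Tu, Tv, Tw\<rbrakk>\<close> with \<open>S\<close> applied to \<open>i\<close> of the arguments \<open>u, v, w\<close>. As \<open>T\<close>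
  is a relative Rota-Baxter operator, this is \<open>T \<Sigma>\<^sub>i\<close>, where \<open>\<Sigma>\<^sub>i\<close> is the corresponding sum for
  the operation that \<open>T\<close> induces on \<open>V\<close>. On the right, the induced ternary operation is quadratic in the operator:
  \<open>\<lbrakk>\<cdot>,\<cdot>,\<cdot>\<rbrakk>\<^sup>R = k\<^sup>2 M + k l P + l\<^sup>2 M'\<close>, where \<open>M\<close> and \<open>M'\<close> belong to \<open>T\<close> and \<open>T S\<close> and \<open>P\<close> is the
  polarization. Applying \<open>T (k + l S)\<close>, what has to be shown is that
  \<open>\<Sigma>\<^sub>1\<close> and \<open>P + S M\<close>, \<open>\<Sigma>\<^sub>2\<close> and \<open>M' + S P\<close>, and finally \<open>\<Sigma>\<^sub>3\<close> and \<open>S M'\<close> have the same image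
  under \<open>T\<close>.

  The extra condition on \<open>(T,S,N)\<close> says exactly that \<open>\<Sigma>\<^sub>1 = P + S M\<close>
  (\<open>rb_tr_one_S\<close>): in \<open>\<Sigma>\<^sub>1\<close> the operator \<open>S\<close> meets either an argument of \<open>T\<close>, which contributes to
  \<open>P\<close>, or the vector acted upon, which contributes \<open>S M\<close>. The hypothesis
  \<open>M' = \<Sigma>\<^sub>2 - S \<Sigma>\<^sub>1 + S\<^sup>2 M\<close> then gives \<open>\<Sigma>\<^sub>2 = M' + S P\<close>. The top coefficient is the Nijenhuis
  identity for \<open>N\<close> at \<open>Tu, Tv, Tw\<close>, transported along \<open>N T = T S\<close>. The induced
  bracket is linear in the operator, so that there the middle coefficient is the hypothesis on
  \<open>[\<cdot>,\<cdot>]\<^sup>T\<^sup>S\<close> itself and the top one is again the Nijenhuis identity. Finally \<open>T\<close> and \<open>T S\<close> themselves are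
  the cases \<open>(k,l) = (1,0)\<close> and \<open>(0,1)\<close>.
\<close>

lemma linear_additive:
  assumes "Vector_Spaces.linear s1 s2 f"
  shows "f (x + y) = f x + f y"
  using assms unfolding Vector_Spaces.linear_def module_hom_def module_hom_axioms_def by blast

lemma linear_homogeneous:
  assumes "Vector_Spaces.linear s1 s2 f"
  shows "f (s1 k x) = s2 k (f x)"
  using assms unfolding Vector_Spaces.linear_def module_hom_def module_hom_axioms_def by blast

lemma linear_subtractive:
  fixes f :: "'a::ab_group_add \<Rightarrow> 'b::ab_group_add"
  assumes "Vector_Spaces.linear s1 s2 f"
  shows "f (x - y) = f x - f y"
  using linear_additive[OF assms, of "x - y" y] by (simp add: algebra_simps)

lemma bilinear_expansion:
  fixes f :: "'a::ab_group_add \<Rightarrow> 'a \<Rightarrow> 'b::ab_group_add"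
  assumes s2: "vector_space s2"
    and 1: "\<And>y. Vector_Spaces.linear s1 s2 (\<lambda>x. f x y)"
    and 2: "\<And>x. Vector_Spaces.linear s1 s2 (f x)"
  shows "f (s1 k x + s1 l x') (s1 k y + s1 l y') =
    s2 (k * k) (f x y) + s2 (k * l) (f x' y + f x y') + s2 (l * l) (f x' y')"
proof -
  interpret vector_space s2 by (rule s2)
  show ?thesis
    by (simp add: linear_additive[OF 1] linear_additive[OF 2] linear_homogeneous[OF 1]
        linear_homogeneous[OF 2] scale_right_distrib mult_ac add_ac)
qed

lemma trilinear_expansion:
  fixes f :: "'a::ab_group_add \<Rightarrow> 'a \<Rightarrow> 'a \<Rightarrow> 'b::ab_group_add"
  assumes s2: "vector_space s2"
    and 1: "\<And>y z. Vector_Spaces.linear s1 s2 (\<lambda>x. f x y z)"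
    and 2: "\<And>x z. Vector_Spaces.linear s1 s2 (\<lambda>y. f x y z)"
    and 3: "\<And>x y. Vector_Spaces.linear s1 s2 (f x y)"
  shows "f (s1 k x + s1 l x') (s1 k y + s1 l y') (s1 k z + s1 l z') =
    s2 (k * k * k) (f x y z) + s2 (k * k * l) (f x' y z + f x y' z + f x y z')
    + s2 (k * l * l) (f x' y' z + f x y' z' + f x' y z') + s2 (l * l * l) (f x' y' z')"
proof -
  interpret vector_space s2 by (rule s2)
  show ?thesis
    by (simp add: linear_additive[OF 1] linear_additive[OF 2] linear_additive[OF 3]
        linear_homogeneous[OF 1] linear_homogeneous[OF 2] linear_homogeneous[OF 3]
        scale_right_distrib mult_ac add_ac)
qed

definition rb_tr_polar ::
  "('g \<Rightarrow> 'g \<Rightarrow> 'g) \<Rightarrow> ('g \<Rightarrow> 'v \<Rightarrow> 'v) \<Rightarrow> ('g \<Rightarrow> 'g \<Rightarrow> 'v \<Rightarrow> 'v) \<Rightarrow> ('v \<Rightarrow> 'g) \<Rightarrow>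
    ('v \<Rightarrow> 'g) \<Rightarrow> 'v \<Rightarrow> 'v \<Rightarrow> 'v \<Rightarrow> 'v::ab_group_add"
  where "rb_tr_polar br \<rho> \<mu> T T' u v w =
    (rep_D br \<rho> \<mu> (T' u) (T v) w + rep_D br \<rho> \<mu> (T u) (T' v) w)
    + (\<mu> (T' v) (T w) u + \<mu> (T v) (T' w) u) - (\<mu> (T' u) (T w) v + \<mu> (T u) (T' w) v)"

text \<open>
  This is where the compatibility condition enters: in each summand of
  \<open>\<lbrakk>\<cdot>,\<cdot>,\<cdot>\<rbrakk>\<^sup>T\<close> two entries pass through \<open>T\<close> and the third is acted upon. Placing \<open>S\<close> on the
  former produces the polarization at \<open>(T, T S)\<close>, and placing it on the latter produces the
  left-hand side of the condition.
\<close>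

lemma rb_tr_one_S:
  assumes "rep_D br \<rho> \<mu> (T u) (T v) (S w) + \<mu> (T v) (T w) (S u) - \<mu> (T u) (T w) (S v)
    = S (rb_tr br \<rho> \<mu> T u v w)"
  shows "rb_tr br \<rho> \<mu> T (S u) v w + rb_tr br \<rho> \<mu> T u (S v) w + rb_tr br \<rho> \<mu> T u v (S w)
    = rb_tr_polar br \<rho> \<mu> T (T \<circ> S) u v w + S (rb_tr br \<rho> \<mu> T u v w)"
  unfolding assms[symmetric] by (simp add: rb_tr_def rb_tr_polar_def)

context lieyrep_pair
begin

lemma vector_space_v: "vector_space scale_v" by unfold_locales

lemma rep_D_linear1: "Vector_Spaces.linear scale_g scale_v (\<lambda>x. rep_D br \<rho> \<mu> x y v)"
proof -
  interpret P: vector_space_pair scale_g scale_v by unfold_locales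
  show ?thesis
    unfolding rep_D_def
    by (intro P.linear_compose_add P.linear_compose_sub \<mu>_linear1 \<mu>_linear2 \<rho>_linear
        Vector_Spaces.linear_compose[OF \<rho>_linear \<rho>_endo, unfolded comp_def]
        Vector_Spaces.linear_compose[OF br_linear1 \<rho>_linear, unfolded comp_def])
qed

lemma rep_D_linear2: "Vector_Spaces.linear scale_g scale_v (\<lambda>y. rep_D br \<rho> \<mu> x y v)"
proof -
  interpret P: vector_space_pair scale_g scale_v by unfold_locales
  show ?thesis
    unfolding rep_D_def
    by (intro P.linear_compose_add P.linear_compose_sub \<mu>_linear1 \<mu>_linear2 \<rho>_linear
        Vector_Spaces.linear_compose[OF \<rho>_linear \<rho>_endo, unfolded comp_def]
        Vector_Spaces.linear_compose[OF br_linear2 \<rho>_linear, unfolded comp_def])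
qed

lemma rb_br_combination:
  "rb_br \<rho> (\<lambda>u. scale_g k (T u) + scale_g l (T' u)) u v =
    scale_v k (rb_br \<rho> T u v) + scale_v l (rb_br \<rho> T' u v)"
  by (simp add: rb_br_def linear_additive[OF \<rho>_linear] linear_homogeneous[OF \<rho>_linear]
      V.scale_right_diff_distrib)

lemma rb_tr_combination:
  "rb_tr br \<rho> \<mu> (\<lambda>u. scale_g k (T u) + scale_g l (T' u)) u v w =
    scale_v (k * k) (rb_tr br \<rho> \<mu> T u v w) + scale_v (k * l) (rb_tr_polar br \<rho> \<mu> T T' u v w)
    + scale_v (l * l) (rb_tr br \<rho> \<mu> T' u v w)"
  unfolding rb_tr_def rb_tr_polar_def
    bilinear_expansion[OF vector_space_v rep_D_linear1 rep_D_linear2]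
    bilinear_expansion[OF vector_space_v \<mu>_linear1 \<mu>_linear2]
  by (simp add: V.scale_right_distrib V.scale_right_diff_distrib)

text \<open>
  Every operator of the pencil spanned by \<open>T\<close> and \<open>T S\<close> is treated at once; comparing
  coefficients in \<open>k\<close> and \<open>l\<close> also covers \<open>T S\<close> itself.
\<close>

lemma rota_baxter_pencil:
  assumes rbn: "rota_baxter_nijenhuis scale_g br tr scale_v \<rho> \<mu> T S N"
    and cond: "\<And>u v w. rep_D br \<rho> \<mu> (T u) (T v) (S w) + \<mu> (T v) (T w) (S u) - \<mu> (T u) (T w) (S v)
                 = S (rb_tr br \<rho> \<mu> T u v w)"
  shows "relative_rota_baxter scale_g br tr scale_v \<rho> \<mu>
    (\<lambda>u. scale_g k (T u) + scale_g l ((T \<circ> S) u))"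
proof -
  define b where "b = rb_br \<rho> T"
  define b' where "b' = rb_br \<rho> (T \<circ> S)"
  define m where "m = rb_tr br \<rho> \<mu> T"
  define p where "p = rb_tr_polar br \<rho> \<mu> T (T \<circ> S)"
  define m' where "m' = rb_tr br \<rho> \<mu> (T \<circ> S)"
  have T: "Vector_Spaces.linear scale_v scale_g T"
    and Tbr: "br (T u) (T v) = T (b u v)"
    and Ttr: "tr (T u) (T v) (T w) = T (m u v w)"
    and S: "Vector_Spaces.linear scale_v scale_v S"
    and N: "Vector_Spaces.linear scale_g scale_g N"
    and Nbr: "br (N x) (N y) = N (deform2 N br x y)"
    and Ntr: "tr (N x) (N y) (N z) = N (deform3 N tr x y z)"
    and NT: "N \<circ> T = T \<circ> S"
    for u v w x y z
    using rbn unfolding rota_baxter_nijenhuis_def relative_rota_baxter_def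
      nijenhuis_structure_def nijenhuis_operator_def b_def m_def by blast+
  have b': "b' u v = b (S u) v + b u (S v) - S (b u v)"
    and m': "m' u v w = m (S u) (S v) w + m u (S v) (S w) + m (S u) v (S w)
      - S (m (S u) v w + m u (S v) w + m u v (S w)) + S (S (m u v w))" for u v w
    using rbn unfolding rota_baxter_nijenhuis_def NT b_def b'_def m_def m'_def
    by (metis deform2_def, metis deform3_def)
  have NT': "N (T u) = T (S u)" for u using NT by (metis comp_apply)
  note T_simps = linear_additive[OF T] linear_subtractive[OF T] linear_homogeneous[OF T]
  note S_simps = linear_additive[OF S] linear_subtractive[OF S] linear_homogeneous[OF S]
  note N_simps = linear_additive[OF N] linear_subtractive[OF N]
  have p: "m (S u) v w + m u (S v) w + m u v (S w) = p u v w + S (m u v w)" for u v w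
    unfolding m_def p_def using cond by (rule rb_tr_one_S[of br \<rho> \<mu> T u v S w])
  have b1: "br (T (S u)) (T v) + br (T u) (T (S v)) = T (b' u v) + T (S (b u v))" for u v
    by (simp add: Tbr b' T_simps)
  have b2: "br (T (S u)) (T (S v)) = T (S (b' u v))" for u v
    using Nbr[of "T u" "T v"] by (simp add: deform2_def NT' Tbr b' N_simps T_simps S_simps)
  have t1: "tr (T (S u)) (T v) (T w) + tr (T u) (T (S v)) (T w) + tr (T u) (T v) (T (S w))
      = T (p u v w) + T (S (m u v w))" for u v w
    using p[of u v w] by (simp add: Ttr flip: linear_additive[OF T])
  \<comment> \<open>Eliminating the terms with a single \<open>S\<close> from \<open>m'\<close> leaves those with two.\<close>
  have p2: "m (S u) (S v) w + m u (S v) (S w) + m (S u) v (S w) = m' u v w + S (p u v w)"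
    for u v w
    unfolding m' p by (simp add: S_simps)
  have t2: "tr (T (S u)) (T (S v)) (T w) + tr (T u) (T (S v)) (T (S w))
        + tr (T (S u)) (T v) (T (S w)) = T (m' u v w) + T (S (p u v w))" for u v w
    using p2[of u v w] by (simp add: Ttr flip: linear_additive[OF T])
  have t3: "tr (T (S u)) (T (S v)) (T (S w)) = T (S (m' u v w))" for u v w
    using Ntr[of "T u" "T v" "T w"]
    by (simp add: deform3_def NT' Ttr m' N_simps T_simps S_simps)
  let ?R = "\<lambda>u. scale_g k (T u) + scale_g l (T (S u))"
  have "Vector_Spaces.linear scale_v scale_g ?R"
  proof -
    interpret P: vector_space_pair scale_v scale_g by unfold_locales
    show ?thesis
      by (intro P.linear_compose_add P.linear_compose_scale_right T
          Vector_Spaces.linear_compose[OF S T, unfolded comp_def])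
  qed
  moreover have "br (?R u) (?R v) = ?R (rb_br \<rho> ?R u v)" for u v
  proof -
    have R: "rb_br \<rho> ?R u v = scale_v k (b u v) + scale_v l (b' u v)"
      using rb_br_combination[of k T l "T \<circ> S"] by (simp add: b_def b'_def)
    show ?thesis
      unfolding R bilinear_expansion[OF vector_space_axioms br_linear1 br_linear2] b1 b2
      by (simp add: Tbr T_simps S_simps scale_right_distrib mult.commute add_ac)
  qed
  moreover have "tr (?R u) (?R v) (?R w) = ?R (rb_tr br \<rho> \<mu> ?R u v w)" for u v w
  proof -
    have R: "rb_tr br \<rho> \<mu> ?R u v w =
        scale_v (k * k) (m u v w) + scale_v (k * l) (p u v w) + scale_v (l * l) (m' u v w)"
      using rb_tr_combination[of k T l "T \<circ> S"] by (simp add: m_def p_def m'_def)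
    show ?thesis
      unfolding R t1 t2 t3
        trilinear_expansion[OF vector_space_axioms tr_linear1 tr_linear2 tr_linear3]
      by (simp add: Ttr T_simps S_simps scale_right_distrib mult_ac add_ac)
  qed
  ultimately show ?thesis
    unfolding relative_rota_baxter_def by simp
qed

end

theorem proposition4p10:
  fixes scale_g :: "'k::field_char_0 \<Rightarrow> 'g::ab_group_add \<Rightarrow> 'g" and Basis_g :: "'g set"
    and br :: "'g \<Rightarrow> 'g \<Rightarrow> 'g" and tr :: "'g \<Rightarrow> 'g \<Rightarrow> 'g \<Rightarrow> 'g"
    and scale_v :: "'k \<Rightarrow> 'v::ab_group_add \<Rightarrow> 'v" and Basis_v :: "'v set"
    and \<rho> :: "'g \<Rightarrow> 'v \<Rightarrow> 'v" and \<mu> :: "'g \<Rightarrow> 'g \<Rightarrow> 'v \<Rightarrow> 'v"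
    and T :: "'v \<Rightarrow> 'g" and S :: "'v \<Rightarrow> 'v" and N :: "'g \<Rightarrow> 'g"
  assumes pair: "lieyrep_pair scale_g Basis_g br tr scale_v Basis_v \<rho> \<mu>"
    and rbn: "rota_baxter_nijenhuis scale_g br tr scale_v \<rho> \<mu> T S N"
    and cond: "\<And>u v w. rep_D br \<rho> \<mu> (T u) (T v) (S w) + \<mu> (T v) (T w) (S u) - \<mu> (T u) (T w) (S v)
                 = S (rb_tr br \<rho> \<mu> T u v w)"
  shows "compatible_rota_baxter scale_g br tr scale_v \<rho> \<mu> T (T \<circ> S)"
proof -
  interpret lieyrep_pair scale_g Basis_g br tr scale_v Basis_v \<rho> \<mu> by (rule pair)
  note pencil = rota_baxter_pencil[OF rbn, OF cond]
  have "relative_rota_baxter scale_g br tr scale_v \<rho> \<mu> T"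
    using pencil[of 1 0] by simp
  moreover have "relative_rota_baxter scale_g br tr scale_v \<rho> \<mu> (T \<circ> S)"
    using pencil[of 0 1] by (simp add: comp_def)
  ultimately show ?thesis
    using pencil unfolding compatible_rota_baxter_def by blast
qed

end
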